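(* There are a computable functional $\Gamma:\omega^\omega\to 2^\omega$ (total on $\omega^\omega$) and a (possibly partial) computable functional $\hat\Gamma$ from $2^\omega$ to $\omega^\omega$ such that for all $f\in\omega^\omega$: (1) $\Gamma$ is a uniform coarse reduction of $\Gamma(f)$ to $f$, i.e., $\Gamma(f')$ is a coarse description of $\Gamma(f)$ for every coarse description $f'$ of $f$; (2) $\hat\Gamma(\Gamma(f))=f$, i.e., $\hat\Gamma\circ\Gamma=\mathrm{id}$; (3) $\hat\Gamma$ is a uniform coarse reduction of $f$ to $\Gamma(f)$, i.e., $\hat\Gamma(X')$ is defined (total) and is a coarse description of $f$ for every coarse description $X'\in 2^\omega$ of $\Gamma(f)$.
   Context: Sets are identified with characteristic functions, so $2^\omega\subseteq\omega^\omega$. A set $S\subseteq\omega$ has density $0$ iff $\lim_{l\to\infty}|S\cap\{0,\dots,l-1\}|/l=0$. For total $f,f':\omega\to\omega$, $f'$ is a coarse description of $f$ if $\{x: f(x)\ne f'(x)\}$ has density $0$. For a set it makes no difference to consider only coarse descriptions that are themselves sets (replace each nonzero value by $1$). *)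

theory Defs
  imports Complex_Main
begin

section \<open>Partial recursive functions relative to a function\<close>

datatype rel_prog =
    Zero
  | Succ
  | Proj nat
  | Query
  | Comp rel_prog "rel_prog list"
  | PrimRec rel_prog rel_prog
  | Mu rel_prog

text \<open>
  \<open>computes f p xs y\<close>: program \<open>p\<close>, which may query \<open>f\<close>, halts on the argument tuple \<open>xs\<close> with value \<open>y\<close>.
  Programs applied to tuples of an unsuitable length diverge; \<open>Zero\<close> is the constant zero function
  of every arity. In \<open>Mu\<close>, the values below the zero that is found have to be defined.
\<close>

inductive computes :: "(nat \<Rightarrow> nat) \<Rightarrow> rel_prog \<Rightarrow> nat list \<Rightarrow> nat \<Rightarrow> bool"
  for f :: "nat \<Rightarrow> nat" where
  zero: "computes f Zero xs 0"
| succ: "computes f Succ [x] (Suc x)"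
| proj: "i < length xs \<Longrightarrow> computes f (Proj i) xs (xs ! i)"
| query: "computes f Query [x] (f x)"
| comp: "list_all2 (\<lambda>q y. computes f q xs y) qs ys \<Longrightarrow> computes f p ys z
    \<Longrightarrow> computes f (Comp p qs) xs z"
| primrec_0: "computes f p xs y \<Longrightarrow> computes f (PrimRec p q) (0 # xs) y"
| primrec_Suc: "computes f (PrimRec p q) (n # xs) r \<Longrightarrow> computes f q (n # r # xs) y
    \<Longrightarrow> computes f (PrimRec p q) (Suc n # xs) y"
| mu: "computes f p (n # xs) 0 \<Longrightarrow> (\<forall>m<n. \<exists>v. computes f p (m # xs) (Suc v))
    \<Longrightarrow> computes f (Mu p) xs n"

inductive_cases computes_ZeroE: "computes f Zero xs z"
inductive_cases computes_SuccE: "computes f Succ xs z"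
inductive_cases computes_ProjE: "computes f (Proj i) xs z"
inductive_cases computes_QueryE: "computes f Query xs z"
inductive_cases computes_CompE: "computes f (Comp p qs) xs z"
inductive_cases computes_PrimRec_0E: "computes f (PrimRec p q) (0 # xs) z"
inductive_cases computes_PrimRec_SucE: "computes f (PrimRec p q) (Suc n # xs) z"
inductive_cases computes_MuE: "computes f (Mu p) xs z"

lemma computes_deterministic:
  "computes f p xs y \<Longrightarrow> computes f p xs z \<Longrightarrow> y = z"
proof (induction arbitrary: z rule: computes.induct)
  case (comp xs qs ys p y)
  from comp.prems obtain ys' where
    *: "list_all2 (\<lambda>q y. computes f q xs y) qs ys'" "computes f p ys' z"
    by (rule computes_CompE)
  have "ys = ys'"
    using comp.IH(1) *(1) by (auto simp: list_all2_conv_all_nth intro!: nth_equalityI)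
  with comp.IH(2) *(2) show ?case by blast
next
  case (primrec_Suc p q n xs r y)
  from primrec_Suc.prems obtain r' where
    "computes f (PrimRec p q) (n # xs) r'" "computes f q (n # r' # xs) z"
    by (rule computes_PrimRec_SucE)
  with primrec_Suc.IH show ?case by blast
next
  case (mu p n xs)
  from mu.prems have 1: "computes f p (z # xs) 0"
    and 2: "\<forall>m<z. \<exists>v. computes f p (m # xs) (Suc v)"
    by (auto elim: computes_MuE)
  show ?case
  proof (rule linorder_cases[of n z])
    assume "n < z"
    with 2 mu.IH(1) show ?thesis by fastforce
  next
    assume "z < n"
    with 1 mu.IH(2) show ?thesis by fastforce
  qed
qed (blast elim: computes_ZeroE computes_SuccE computes_ProjE computes_QueryE computes_PrimRec_0E)+


section \<open>Computable functionals\<close>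

text \<open>The Cantor space, as a subset of the Baire space \<^typ>\<open>nat \<Rightarrow> nat\<close>.\<close>

definition cantor :: "(nat \<Rightarrow> nat) set" where
  "cantor = {X. range X \<subseteq> {0, 1}}"

text \<open>
  A partial functional from \<open>A\<close> to \<open>B\<close> is computable if a single program induces it. It is defined
  at \<open>f\<close> exactly when the program, relative to \<open>f\<close>, halts on every input.
\<close>

definition partial_computable_functional ::
  "(nat \<Rightarrow> nat) set \<Rightarrow> (nat \<Rightarrow> nat) set \<Rightarrow> ((nat \<Rightarrow> nat) \<rightharpoonup> (nat \<Rightarrow> nat)) \<Rightarrow> bool" where
  "partial_computable_functional A B \<Phi> \<longleftrightarrow>
     dom \<Phi> \<subseteq> A \<and> ran \<Phi> \<subseteq> B \<and>
     (\<exists>p. \<forall>f\<in>A. \<forall>g. \<Phi> f = Some g \<longleftrightarrow> (\<forall>x. computes f p [x] (g x)))"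

definition computable_functional ::
  "(nat \<Rightarrow> nat) set \<Rightarrow> ((nat \<Rightarrow> nat) \<Rightarrow> (nat \<Rightarrow> nat)) \<Rightarrow> bool" where
  "computable_functional B \<Phi> \<longleftrightarrow> partial_computable_functional UNIV B (\<lambda>f. Some (\<Phi> f))"


section \<open>Coarse descriptions and uniform coarse reductions\<close>

definition density_zero :: "nat set \<Rightarrow> bool" where
  "density_zero S \<longleftrightarrow> (\<lambda>l. real (card (S \<inter> {..<l})) / real l) \<longlonglongrightarrow> 0"

definition coarse_description :: "(nat \<Rightarrow> nat) \<Rightarrow> (nat \<Rightarrow> nat) \<Rightarrow> bool" where
  "coarse_description f' f \<longleftrightarrow> density_zero {x. f x \<noteq> f' x}"

text \<open>\<open>\<Phi>\<close> uniformly reduces \<open>g\<close> to \<open>f\<close>, where only the coarse descriptions of \<open>f\<close> in \<open>A\<close> count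
  as inputs. Computability of \<open>\<Phi>\<close> is not part of this predicate.\<close>

definition uniform_coarse_reduction ::
  "(nat \<Rightarrow> nat) set \<Rightarrow> ((nat \<Rightarrow> nat) \<rightharpoonup> (nat \<Rightarrow> nat)) \<Rightarrow> (nat \<Rightarrow> nat) \<Rightarrow> (nat \<Rightarrow> nat) \<Rightarrow> bool" where
  "uniform_coarse_reduction A \<Phi> g f \<longleftrightarrow>
     (\<forall>f'\<in>A. coarse_description f' f \<longrightarrow> (\<exists>g'. \<Phi> f' = Some g' \<and> coarse_description g' g))"

end

theory Submission
  imports Defs "HOL-Library.Discrete_Functions"
begin

text \<open>
  Both a function \<open>f\<close> and its code \<open>\<Gamma> f\<close> are cut into dyadic blocks, block \<open>i\<close> having length \<open>2 ^ i\<close>.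
  A set has density zero iff its relative size in block \<open>i\<close> tends to \<open>0\<close>, so that coarse
  descriptions become a matter of relative Hamming distance on blocks.

  The difficulty is that the values of \<open>f\<close> are unbounded. If \<open>f n\<close> influences bits of \<open>\<Gamma> f\<close> of
  positive upper density, then changing one value is too expensive. So the record of \<open>f n\<close> has to
  fade out, but at a place that depends on \<open>f\<close>, because no fixed place is late enough for all values;
  and decoding has to recognise this place from corrupted data. The way out is to let
  block \<open>j\<close> of \<open>f\<close> be recorded for every \<open>k\<close> separately, in blocks of \<open>\<Gamma> f\<close> of its own, and to let the
  record fade out as \<open>k\<close> passes the values of \<open>f\<close> on block \<open>j\<close>. Record \<open>(j, k)\<close> consists
  of \<open>2 ^ j\<close> equal parts, one for every position \<open>m\<close> of the block. Part \<open>m\<close> is zero if \<open>f m < k\<close>;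
  otherwise it contains, for every position \<open>n\<close>, the long code of \<open>f n\<close> truncated at \<open>k + 1\<close>, that is,
  the list of bit number \<open>f n\<close> of all \<open>y < 2 ^ h\<close>. Different numbers have codes that differ in
  exactly half of the places.

  Changing \<open>f\<close> in a fraction \<open>q\<close> of block \<open>j\<close> changes a fraction of at most \<open>2 * q\<close> of each record
  (\<open>rel_dist_codeword_le\<close>), and for fixed \<open>j\<close> almost all records are zero; hence \<open>\<Gamma>\<close> maps coarse
  descriptions to coarse descriptions (\<open>coarse_description_encode\<close>).
  Conversely, two functions that differ in a fraction \<open>q\<close> of block \<open>j\<close> have some record in
  which they differ in a fraction of at least \<open>q ^ 2 / 16\<close> (\<open>codeword_separation\<close>): for the right
  \<open>k\<close>, a fixed proportion of the positions where they differ carries values at least \<open>k\<close>,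
  which opens these parts, and a fixed proportion carries values at most \<open>k\<close>, which are
  fully recorded there. Neither estimate depends on \<open>k\<close> or on the size of the values.

  To decode block \<open>j\<close> from \<open>X\<close>, search for a \<open>K\<close> whose record is nearly zero. It exists since the
  errors in \<open>X\<close> tend to \<open>0\<close> along the records of \<open>j\<close>, and it shows that most values of \<open>f\<close> on the
  block are below \<open>K\<close>. Then take, among the finitely many functions with values at most \<open>K\<close>, one
  whose records up to \<open>K\<close> are, up to rounding, closest to \<open>X\<close> in the worst case. By the separation
  of the records it agrees with \<open>f\<close> on most of the block (\<open>nearest_approx\<close>), and on the whole block
  if \<open>X\<close> has no errors (\<open>nearest_exact\<close>). The search for \<open>K\<close> is the only unbounded one that may fail.
\<close>

section \<open>Relative distance on dyadic blocks\<close>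

definition mismatches :: "nat \<Rightarrow> (nat \<Rightarrow> nat) \<Rightarrow> (nat \<Rightarrow> nat) \<Rightarrow> nat" where
  "mismatches i u v = (\<Sum>z<2 ^ i. of_bool (u z \<noteq> v z))"

definition rel_dist :: "nat \<Rightarrow> (nat \<Rightarrow> nat) \<Rightarrow> (nat \<Rightarrow> nat) \<Rightarrow> real" where
  "rel_dist i u v = real (mismatches i u v) / 2 ^ i"

text \<open>
  The blocks are the intervals \<open>{2 ^ i - 1..<2 ^ Suc i - 1}\<close>. The shift by one lets them cover \<open>0\<close>
  as well, which matters because decoding has to recover \<open>f 0\<close> exactly.
\<close>

definition block :: "(nat \<Rightarrow> nat) \<Rightarrow> nat \<Rightarrow> nat \<Rightarrow> nat" where
  "block f i = (\<lambda>z. f (2 ^ i - 1 + z))"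

lemma mismatches_eq_card: "mismatches i u v = card {z. z < 2 ^ i \<and> u z \<noteq> v z}"
  by (simp add: mismatches_def sum_of_bool_eq Collect_conj_eq lessThan_def[symmetric])

lemma mismatches_eq_0_iff: "mismatches i u v = 0 \<longleftrightarrow> (\<forall>z<2 ^ i. u z = v z)"
  by (auto simp: mismatches_def)

lemma mismatches_le: "mismatches i u v \<le> 2 ^ i"
  using sum_mono[of "{..<2 ^ i}" "\<lambda>z. of_bool (u z \<noteq> v z) :: nat" "\<lambda>_. 1"]
  by (simp add: mismatches_def)

lemma mismatches_commute: "mismatches i u v = mismatches i v u"
  by (simp add: mismatches_def eq_commute)

lemma rel_dist_commute: "rel_dist i u v = rel_dist i v u"
  by (simp add: rel_dist_def mismatches_commute)

lemma rel_dist_nonneg [simp]: "0 \<le> rel_dist i u v"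
  by (simp add: rel_dist_def)

lemma rel_dist_eq_0_iff: "rel_dist i u v = 0 \<longleftrightarrow> (\<forall>z<2 ^ i. u z = v z)"
  by (simp add: rel_dist_def mismatches_eq_0_iff)

lemma rel_dist_cong:
  assumes "\<And>z. z < 2 ^ i \<Longrightarrow> u z = u' z" "\<And>z. z < 2 ^ i \<Longrightarrow> v z = v' z"
  shows "rel_dist i u v = rel_dist i u' v'"
proof -
  have "mismatches i u v = mismatches i u' v'"
    unfolding mismatches_def by (rule sum.cong) (simp_all add: assms)
  then show ?thesis
    by (simp add: rel_dist_def)
qed

lemma rel_dist_triangle: "rel_dist i u w \<le> rel_dist i u v + rel_dist i v w"
proof -
  have "mismatches i u w \<le> mismatches i u v + mismatches i v w"
    unfolding mismatches_def sum.distrib[symmetric] by (rule sum_mono) auto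
  then show ?thesis
    by (simp add: rel_dist_def divide_right_mono flip: add_divide_distrib of_nat_add)
qed

lemma floor_log_block: "z < 2 ^ i \<Longrightarrow> floor_log (Suc (2 ^ i - 1 + z)) = i"
  by (rule floor_log_eqI) auto

lemma card_block:
  "mismatches i (block f i) (block g i) = card ({x. f x \<noteq> g x} \<inter> {2 ^ i - 1..<2 ^ Suc i - 1})"
proof -
  have "bij_betw (\<lambda>z. 2 ^ i - 1 + z) {z. z < 2 ^ i \<and> block f i z \<noteq> block g i z}
      ({x. f x \<noteq> g x} \<inter> {2 ^ i - 1..<2 ^ Suc i - 1})"
    by (rule bij_betw_byWitness[where f' = "\<lambda>x. x - (2 ^ i - 1)"]) (auto simp: block_def)
  then show ?thesis
    by (simp add: mismatches_eq_card bij_betw_same_card)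
qed

text \<open>
  Block \<open>i\<close> makes up about half of the initial segment that ends with it, so its relative error is at
  most twice that of this segment.
\<close>

lemma rel_dist_block_tendsto_0:
  assumes "coarse_description g f"
  shows "(\<lambda>i. rel_dist i (block f i) (block g i)) \<longlonglongrightarrow> 0"
proof -
  let ?S = "{x. f x \<noteq> g x}"
  have lim: "filterlim (\<lambda>i. 2 ^ Suc i :: nat) sequentially sequentially"
  proof (rule filterlim_at_top_mono[OF filterlim_Suc], rule always_eventually, rule allI)
    show "Suc i \<le> 2 ^ Suc i" for i
      by (rule less_imp_le, rule less_exp)
  qed
  have "(\<lambda>l. real (card (?S \<inter> {..<l})) / real l) \<longlonglongrightarrow> 0"
    using assms by (simp add: coarse_description_def density_zero_def)
  from tendsto_mult_left[OF filterlim_compose[OF this lim], of 2]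
  have "(\<lambda>i. 2 * (real (card (?S \<inter> {..<2 ^ Suc i})) / real (2 ^ Suc i))) \<longlonglongrightarrow> 0"
    by simp
  then show ?thesis
  proof (rule tendsto_sandwich[OF _ _ tendsto_const, rotated 2])
    have "card (?S \<inter> {2 ^ i - 1..<2 ^ Suc i - 1}) \<le> card (?S \<inter> {..<2 ^ Suc i})" for i
      by (rule card_mono) auto
    then show "\<forall>\<^sub>F i in sequentially. rel_dist i (block f i) (block g i)
        \<le> 2 * (real (card (?S \<inter> {..<2 ^ Suc i})) / real (2 ^ Suc i))"
      by (simp add: rel_dist_def card_block divide_right_mono)
  qed simp
qed

text \<open>
  An initial segment of length \<open>l\<close> is covered by the blocks that start in it. Their lengths form a
  geometric progression with sum \<open>O(l)\<close>, so small relative errors in all late blocks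
  add up to a small relative error, and the early blocks contribute a constant.
\<close>

lemma coarse_description_if_rel_dist_block_tendsto_0:
  assumes "(\<lambda>i. rel_dist i (block f i) (block g i)) \<longlonglongrightarrow> 0"
  shows "coarse_description g f"
proof -
  let ?S = "{x. f x \<noteq> g x}"
  define m where "m i = mismatches i (block f i) (block g i)" for i
  have m_le: "m i \<le> 2 ^ i" for i
    by (simp add: m_def mismatches_le)
  have card_le: "card (?S \<inter> {..<l}) \<le> (\<Sum>i\<le>floor_log l. m i)" for l
  proof -
    have "?S \<inter> {..<l} \<subseteq> (\<Union>i\<le>floor_log l. ?S \<inter> {2 ^ i - 1..<2 ^ Suc i - 1})"
    proof
      fix x assume x: "x \<in> ?S \<inter> {..<l}"
      then have "floor_log (Suc x) \<le> floor_log l"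
        by (intro floor_log_le_iff) simp
      moreover have "2 ^ floor_log (Suc x) - 1 \<le> x" "x < 2 ^ Suc (floor_log (Suc x)) - 1"
        using floor_log_exp2_le[of "Suc x"] floor_log_exp2_gt[of "Suc x"] by simp_all
      ultimately show "x \<in> (\<Union>i\<le>floor_log l. ?S \<inter> {2 ^ i - 1..<2 ^ Suc i - 1})"
        using x by auto
    qed
    then have "card (?S \<inter> {..<l}) \<le> card (\<Union>i\<le>floor_log l. ?S \<inter> {2 ^ i - 1..<2 ^ Suc i - 1})"
      by (intro card_mono) auto
    also have "\<dots> \<le> (\<Sum>i\<le>floor_log l. m i)"
      unfolding m_def card_block by (rule card_UN_le) simp
    finally show ?thesis .
  qed
  have "(\<lambda>l. real (card (?S \<inter> {..<l})) / real l) \<longlonglongrightarrow> 0"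
  proof (rule LIMSEQ_I)
    fix e :: real assume "e > 0"
    then obtain J where J: "\<And>i. i \<ge> J \<Longrightarrow> real (m i) / 2 ^ i < e / 4"
      using LIMSEQ_D[OF assms, of "e / 4"] by (auto simp: rel_dist_def m_def)
    have m_bound: "real (m i) \<le> (if i < J then 2 ^ i else 0) + e / 4 * 2 ^ i" for i
    proof (cases "i < J")
      case True
      have "real (m i) \<le> 2 ^ i"
        using m_le[of i] by (metis of_nat_le_iff of_nat_numeral of_nat_power)
      then show ?thesis
        using True \<open>e > 0\<close> by (simp add: add_increasing2)
    qed (use J[of i] in \<open>simp add: field_simps\<close>)
    have geom: "(\<Sum>i\<in>I. 2 ^ i) \<le> (2::real) ^ n" if "I \<subseteq> {..<n}" for I n
    proof -
      have "(\<Sum>i\<in>I. 2 ^ i) \<le> (\<Sum>i<n. (2::real) ^ i)"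
        by (rule sum_mono2) (use that in auto)
      also have "\<dots> \<le> 2 ^ n"
        by (induction n) auto
      finally show ?thesis .
    qed
    have bound: "real (card (?S \<inter> {..<l})) \<le> 2 ^ J + e / 2 * real l" if "l > 0" for l
    proof -
      let ?L = "floor_log l"
      have "real (card (?S \<inter> {..<l})) \<le> (\<Sum>i\<le>?L. real (m i))"
        using card_le[of l] by (metis of_nat_le_iff of_nat_sum)
      also have "\<dots> \<le> (\<Sum>i\<le>?L. (if i < J then 2 ^ i else 0) + e / 4 * 2 ^ i)"
        by (rule sum_mono) (rule m_bound)
      also have "\<dots> = (\<Sum>i\<in>{..?L} \<inter> {i. i < J}. 2 ^ i) + e / 4 * (\<Sum>i\<le>?L. 2 ^ i)"
        by (simp add: sum.distrib sum_distrib_left sum.inter_restrict)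
      also have "\<dots> \<le> 2 ^ J + e / 4 * 2 ^ Suc ?L"
        using \<open>e > 0\<close> by (intro add_mono mult_left_mono geom) auto
      also have "(2::real) ^ Suc ?L \<le> 2 * real l"
      proof -
        have "(2::real) ^ ?L \<le> real l"
          using floor_log_exp2_le[OF that] by (metis of_nat_le_iff of_nat_numeral of_nat_power)
        then show ?thesis by simp
      qed
      finally show ?thesis
        using \<open>e > 0\<close> by simp
    qed
    obtain l0 :: nat where l0: "2 ^ J / (e / 2) < real l0"
      using reals_Archimedean2 by blast
    have "norm (real (card (?S \<inter> {..<l})) / real l - 0) < e" if "l \<ge> Suc l0" for l
    proof -
      have "2 ^ J < e / 2 * real l"
        using l0 that \<open>e > 0\<close> less_le_trans[of "2 ^ J / (e / 2)" "real l0" "real l"]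
        by (simp add: field_simps)
      with bound[of l] that have "real (card (?S \<inter> {..<l})) < e * real l"
        by simp
      then show ?thesis
        using that by (simp add: divide_less_eq)
    qed
    then show "\<exists>l0. \<forall>l\<ge>l0. norm (real (card (?S \<inter> {..<l})) / real l - 0) < e"
      by blast
  qed
  then show ?thesis
    by (simp add: coarse_description_def density_zero_def)
qed

section \<open>The code of one block\<close>

lemma sum_mod_div:
  fixes F :: "nat \<Rightarrow> nat \<Rightarrow> nat"
  assumes "0 < a"
  shows "(\<Sum>z<a * b. F (z mod a) (z div a)) = (\<Sum>m<a. \<Sum>w<b. F m w)"
proof -
  have split: "sum G {..<m + n} = sum G {..<m} + (\<Sum>x<n. G (m + x))" for G :: "nat \<Rightarrow> nat" and m n
    by (induction n) auto
  have "(\<Sum>z<a * b. F (z mod a) (z div a)) = (\<Sum>w<b. \<Sum>m<a. F m w)"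
  proof (induction b)
    case (Suc b)
    then show ?case
      using assms by (auto simp: split add.commute[of a] intro!: sum.cong)
  qed simp
  also have "\<dots> = (\<Sum>m<a. \<Sum>w<b. F m w)"
    by (rule sum.swap)
  finally show ?thesis .
qed

text \<open>
  A number \<open>z < 2 ^ i\<close> is a triple of two numbers below \<open>2 ^ j\<close> and one below \<open>2 ^ (i - 2 * j)\<close>; as all
  bounds are powers of two, no remainder spoils the counting.
\<close>

lemma sum_mod_mod_div:
  fixes F :: "nat \<Rightarrow> nat \<Rightarrow> nat \<Rightarrow> nat"
  assumes "2 * j \<le> i"
  shows "(\<Sum>z<2 ^ i. F (z mod 2 ^ j) (z div 2 ^ j mod 2 ^ j) (z div 2 ^ j div 2 ^ j))
    = (\<Sum>m<2 ^ j. \<Sum>n<2 ^ j. \<Sum>y<2 ^ (i - 2 * j). F m n y)"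
proof -
  have "(2::nat) ^ i = 2 ^ j * (2 ^ j * 2 ^ (i - 2 * j))"
    using assms by (simp flip: power_add)
  then show ?thesis
    using sum_mod_div[of "2 ^ j" "\<lambda>m w. F m (w mod 2 ^ j) (w div 2 ^ j)" "2 ^ j * 2 ^ (i - 2 * j)"]
    by (simp add: sum_mod_div)
qed

text \<open>
  The record of \<open>g\<close>, restricted to \<open>{..<2 ^ j}\<close>, with threshold \<open>k\<close>. Position \<open>z\<close> is read as the triple of
  \<open>m = z mod 2 ^ j\<close>, \<open>n = z div 2 ^ j mod 2 ^ j\<close> and the remaining digits \<open>y\<close>. If \<open>g m \<ge> k\<close>, it
  contains bit number \<open>g n\<close> of \<open>y\<close>, where all values above \<open>k\<close> are recorded as \<open>Suc k\<close>: so \<open>k + 2\<close> bits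
  of \<open>y\<close> suffice for any \<open>g\<close>.
  
  The proportion of nonzero parts is the proportion of \<open>m\<close> with \<open>g m \<ge> k\<close>. It varies continuously with
  \<open>g\<close>, in contrast to a rule such as "record until the maximum of \<open>g\<close> is reached", which a single
  large value could delay arbitrarily.
\<close>

definition codeword :: "nat \<Rightarrow> nat \<Rightarrow> (nat \<Rightarrow> nat) \<Rightarrow> nat \<Rightarrow> nat" where
  "codeword j k g z =
     (if k \<le> g (z mod 2 ^ j)
      then z div 2 ^ j div 2 ^ j div 2 ^ min (g (z div 2 ^ j mod 2 ^ j)) (Suc k) mod 2 else 0)"

lemma codeword_eq_0:
  assumes "\<And>a. a < 2 ^ j \<Longrightarrow> g a < k"
  shows "codeword j k g = (\<lambda>_. 0)"
proof -
  have "\<not> k \<le> g (z mod 2 ^ j)" for z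
    using assms[of "z mod 2 ^ j"] by simp
  then show ?thesis
    by (simp add: codeword_def fun_eq_iff)
qed

text \<open>
  The bit at \<open>z\<close> depends on \<open>g m\<close> and \<open>g n\<close> only, and both \<open>m\<close> and \<open>n\<close> are equidistributed.
\<close>

lemma rel_dist_codeword_le:
  assumes "2 * j \<le> i"
  shows "rel_dist i (codeword j k g) (codeword j k g') \<le> 2 * rel_dist j g g'"
proof -
  define N H where "N = (2::nat) ^ j" and "H = (2::nat) ^ (i - 2 * j)"
  have 2: "(2::nat) ^ i = N * N * H"
    using assms by (simp add: N_def H_def flip: power_add)
  have M: "(\<Sum>m<N. of_bool (g m \<noteq> g' m)) = mismatches j g g'"
    by (simp add: mismatches_def N_def)
  have "mismatches i (codeword j k g) (codeword j k g') \<le>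
      (\<Sum>z<2 ^ i. of_bool (g (z mod 2 ^ j) \<noteq> g' (z mod 2 ^ j)) +
         of_bool (g (z div 2 ^ j mod 2 ^ j) \<noteq> g' (z div 2 ^ j mod 2 ^ j)))"
    unfolding mismatches_def by (rule sum_mono) (auto simp: codeword_def)
  also have "\<dots> = (\<Sum>m<N. \<Sum>n<N. \<Sum>y<H. of_bool (g m \<noteq> g' m) + of_bool (g n \<noteq> g' n))"
    unfolding N_def H_def
    by (rule sum_mod_mod_div[OF assms, where F = "\<lambda>m n y. of_bool (g m \<noteq> g' m) + of_bool (g n \<noteq> g' n)"])
  also have "\<dots> = 2 * (N * (H * mismatches j g g'))"
    by (simp add: sum.distrib M flip: sum_distrib_left del: sum_of_bool_eq)
  finally have "real (mismatches i (codeword j k g) (codeword j k g')) \<le> 2 * (real N * (real H * mismatches j g g'))"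
    by (metis of_nat_le_iff of_nat_mult of_nat_numeral)
  moreover have "real N > 0" "real H > 0" "real N = 2 ^ j" "(2::real) ^ i = real N * real N * real H"
    using arg_cong[OF 2, of real] by (simp_all add: N_def H_def)
  ultimately show ?thesis
    by (simp add: rel_dist_def field_simps)
qed

text \<open>
  Flipping bit \<open>v\<close> exchanges the numbers with and without the property.
\<close>

lemma half_of_cube:
  fixes P :: "nat \<Rightarrow> bool"
  assumes "v < h" and flip: "\<And>y. P (flip_bit v y) \<longleftrightarrow> \<not> P y"
  shows "2 * (\<Sum>y<2 ^ h. of_bool (P y)) = (2 ^ h :: nat)"
proof -
  have less: "flip_bit v y < 2 ^ h" if "y < 2 ^ h" for y :: nat
  proof -
    have "take_bit h (flip_bit v y) = flip_bit v y"
      using that assms(1) by (simp add: take_bit_flip_bit_eq take_bit_nat_eq_self)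
    then show ?thesis
      by (metis take_bit_nat_less_exp)
  qed
  have flip2: "flip_bit v (flip_bit v y) = y" for y :: nat
    by (rule bit_eqI) (auto simp: bit_flip_bit_iff)
  have "(\<Sum>y<2 ^ h. of_bool (P y)) = (\<Sum>y<2 ^ h. of_bool (P (flip_bit v y)) :: nat)"
    by (rule sum.reindex_bij_witness[where i = "flip_bit v" and j = "flip_bit v"])
       (auto simp: flip2 less)
  then have "2 * (\<Sum>y<2 ^ h. of_bool (P y)) = (\<Sum>y<2 ^ h. of_bool (P y) + of_bool (\<not> P y) :: nat)"
    by (simp add: sum.distrib flip)
  also have "\<dots> = (\<Sum>y<(2::nat) ^ h. 1)"
    by (rule sum.cong) auto
  finally show ?thesis by simp
qed

lemma mod_2_eq_of_bool_bit: "y div 2 ^ v mod 2 = of_bool (bit y v)" for y :: nat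
  by (simp add: bit_iff_odd mod_2_eq_odd)

lemma half_of_cube_bit:
  assumes "v < h"
  shows "2 * (\<Sum>y<2 ^ h. of_bool ((y::nat) div 2 ^ v mod 2 \<noteq> 0)) = (2 ^ h :: nat)"
  by (rule half_of_cube[OF assms]) (simp add: mod_2_eq_of_bool_bit bit_flip_bit_iff)

lemma half_of_cube_two_bits:
  assumes "v < h" "v \<noteq> w"
  shows "2 * (\<Sum>y<2 ^ h. of_bool ((y::nat) div 2 ^ v mod 2 \<noteq> y div 2 ^ w mod 2)) = (2 ^ h :: nat)"
  by (rule half_of_cube[OF assms(1)])
     (use assms(2) in \<open>auto simp: mod_2_eq_of_bool_bit bit_flip_bit_iff\<close>)

text \<open>
  For \<open>m \<in> A\<close> and \<open>n \<in> B\<close> the record of \<open>g\<close> contains bit number \<open>g n\<close>, while that of \<open>g'\<close> contains either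
  bit number \<open>g' n\<close> or, if \<open>g' m < k\<close>, only zeros. Either way they differ for half of all \<open>y\<close>.
\<close>

lemma mismatches_codeword_ge:
  assumes i: "2 * j + k + 2 \<le> i"
    and A: "A \<subseteq> {..<2 ^ j}" "\<And>m. m \<in> A \<Longrightarrow> k \<le> g m"
    and B: "B \<subseteq> {..<2 ^ j}" "\<And>n. n \<in> B \<Longrightarrow> g n \<noteq> g' n \<and> g n \<le> k \<and> g' n \<le> k"
  shows "card A * card B * 2 ^ (i - 2 * j) \<le> 2 * mismatches i (codeword j k g) (codeword j k g')"
proof -
  define c where "c h m n y = (if k \<le> h m then y div 2 ^ min (h n) (Suc k) mod 2 else 0)"
    for h :: "nat \<Rightarrow> nat" and m n y :: nat
  let ?H = "(2::nat) ^ (i - 2 * j)"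
  have half: "?H = 2 * (\<Sum>y<?H. of_bool (c g m n y \<noteq> c g' m n y))" if "m \<in> A" "n \<in> B" for m n
  proof (cases "k \<le> g' m")
    case True
    have "g n < i - 2 * j"
      using B(2)[OF that(2)] i by linarith
    with True show ?thesis
      using A(2)[OF that(1)] B(2)[OF that(2)] half_of_cube_two_bits[of "g n" "i - 2 * j" "g' n"] i
      by (simp add: c_def del: sum_of_bool_eq)
  next
    case False
    have "g n < i - 2 * j"
      using B(2)[OF that(2)] i by linarith
    with False show ?thesis
      using A(2)[OF that(1)] B(2)[OF that(2)] half_of_cube_bit[of "g n" "i - 2 * j"] i
      by (simp add: c_def del: sum_of_bool_eq)
  qed
  have "card A * card B * ?H = (\<Sum>m\<in>A. \<Sum>n\<in>B. ?H)"
    by simp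
  also have "\<dots> = (\<Sum>m\<in>A. \<Sum>n\<in>B. 2 * (\<Sum>y<?H. of_bool (c g m n y \<noteq> c g' m n y)))"
    using half by (intro sum.cong refl)
  also have "\<dots> \<le> (\<Sum>m<2^j. \<Sum>n\<in>B. 2 * (\<Sum>y<?H. of_bool (c g m n y \<noteq> c g' m n y)))"
    by (rule sum_mono2) (use A in auto)
  also have "\<dots> \<le> (\<Sum>m<2^j. \<Sum>n<2^j. 2 * (\<Sum>y<?H. of_bool (c g m n y \<noteq> c g' m n y)))"
    by (intro sum_mono sum_mono2) (use B in auto)
  also have "\<dots> = 2 * (\<Sum>m<2^j. \<Sum>n<2^j. \<Sum>y<?H. of_bool (c g m n y \<noteq> c g' m n y))"
    by (simp add: sum_distrib_left del: sum_of_bool_eq)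
  also have "\<dots> = 2 * mismatches i (codeword j k g) (codeword j k g')"
    unfolding mismatches_def
    using sum_mod_mod_div[of j i "\<lambda>m n y. of_bool (c g m n y \<noteq> c g' m n y)"] i
    by (simp add: c_def codeword_def del: sum_of_bool_eq)
  finally show ?thesis .
qed

text \<open>
  In a part that is not identically zero half of the bits are ones, so the number of ones in a
  record measures how many values reach the threshold.
\<close>

lemma ones_codeword_ge:
  assumes i: "2 * j + k + 2 \<le> i"
  shows "real (card {m. m < 2 ^ j \<and> k \<le> g m}) / 2 ^ j \<le> 2 * rel_dist i (codeword j k g) (\<lambda>_. 0)"
proof -
  define c where "c m n y = (if k \<le> g m then y div 2 ^ min (g n) (Suc k) mod 2 else 0)"
    for m n y :: nat
  define N H where "N = (2::nat) ^ j" and "H = (2::nat) ^ (i - 2 * j)"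
  define A where "A = {m. m < N \<and> k \<le> g m}"
  have 2: "(2::nat) ^ i = N * N * H"
    using i by (simp add: N_def H_def flip: power_add)
  have half: "H = 2 * (\<Sum>y<H. of_bool (c m n y \<noteq> 0))" if "m \<in> A" for m n
    using half_of_cube_bit[of "min (g n) (Suc k)" "i - 2 * j"] that i
    by (simp add: c_def A_def H_def del: sum_of_bool_eq)
  have "card A * N * H = (\<Sum>m\<in>A. \<Sum>n<N. H)"
    by simp
  also have "\<dots> = (\<Sum>m\<in>A. \<Sum>n<N. 2 * (\<Sum>y<H. of_bool (c m n y \<noteq> 0)))"
    using half by (intro sum.cong refl)
  also have "\<dots> \<le> (\<Sum>m<N. \<Sum>n<N. 2 * (\<Sum>y<H. of_bool (c m n y \<noteq> 0)))"
    by (rule sum_mono2) (auto simp: A_def)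
  also have "\<dots> = 2 * (\<Sum>m<N. \<Sum>n<N. \<Sum>y<H. of_bool (c m n y \<noteq> 0))"
    by (simp add: sum_distrib_left del: sum_of_bool_eq)
  also have "\<dots> = 2 * mismatches i (codeword j k g) (\<lambda>_. 0)"
    unfolding mismatches_def N_def H_def
    using sum_mod_mod_div[of j i "\<lambda>m n y. of_bool (c m n y \<noteq> 0)"] i
    by (simp add: c_def codeword_def del: sum_of_bool_eq)
  finally have "real (card A) * real N * real H \<le> 2 * real (mismatches i (codeword j k g) (\<lambda>_. 0))"
    by (metis of_nat_le_iff of_nat_mult of_nat_numeral)
  moreover have "real N > 0" "real H > 0" "real N = 2 ^ j" "(2::real) ^ i = real N * real N * real H"
    using arg_cong[OF 2, of real] by (simp_all add: N_def H_def)
  ultimately show ?thesis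
    by (simp add: rel_dist_def field_simps A_def N_def)
qed

lemma median:
  fixes h :: "'a \<Rightarrow> nat"
  assumes "finite D" "\<And>n. n \<in> D \<Longrightarrow> h n \<le> K"
  obtains k where "k \<le> K" "card D \<le> 2 * card {n \<in> D. h n \<le> k}" "card D \<le> 2 * card {n \<in> D. k \<le> h n}"
proof -
  define k where "k = (LEAST k. card D \<le> 2 * card {n \<in> D. h n \<le> k})"
  have K: "card D \<le> 2 * card {n \<in> D. h n \<le> K}"
    using assms(2) by (subst Collect_cong[of _ "\<lambda>n. n \<in> D"]) auto
  have 1: "card D \<le> 2 * card {n \<in> D. h n \<le> k}" "k \<le> K"
    unfolding k_def using K by (rule LeastI, rule Least_le)
  have "card D \<le> 2 * card {n \<in> D. k \<le> h n}"
  proof (cases k)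
    case (Suc l)
    have "\<not> card D \<le> 2 * card {n \<in> D. h n \<le> l}"
      by (rule not_less_Least) (simp add: Suc flip: k_def)
    moreover have "card {n \<in> D. h n \<le> l} + card {n \<in> D. k \<le> h n} = card D"
      using assms(1) by (subst card_Un_disjoint[symmetric]) (auto simp: Suc intro!: arg_cong[of _ _ card])
    ultimately show ?thesis by linarith
  qed simp
  then show thesis
    using that 1 by blast
qed

text \<open>
  Let \<open>D\<close> be the set of positions where \<open>g\<close> and \<open>g'\<close> differ, and \<open>k\<close> a median of \<open>max g g'\<close> on \<open>D\<close>. At no
  less than half of the positions in \<open>D\<close> both values are at most \<open>k\<close>; at no less than a quarter of the
  positions in \<open>D\<close> one and the same of the two functions reaches \<open>k\<close>. Together they form at least
  \<open>(card D)\<^sup>2 / 8\<close> pairs, and half of the bits belonging to each pair differ. The bound does not depend on \<open>K\<close>.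
\<close>

lemma codeword_separation:
  assumes g: "\<And>n. n < 2 ^ j \<Longrightarrow> g n \<le> K" "\<And>n. n < 2 ^ j \<Longrightarrow> g' n \<le> K"
  obtains k where "k \<le> K"
    and "\<And>i. 2 * j + k + 2 \<le> i \<Longrightarrow>
      (rel_dist j g g')\<^sup>2 \<le> 16 * rel_dist i (codeword j k g) (codeword j k g')"
proof -
  define D where "D = {n. n < 2 ^ j \<and> g n \<noteq> g' n}"
  have fin: "finite D"
    by (simp add: D_def)
  obtain k where k: "k \<le> K" "card D \<le> 2 * card {n \<in> D. max (g n) (g' n) \<le> k}"
      "card D \<le> 2 * card {n \<in> D. k \<le> max (g n) (g' n)}"
    by (rule median[OF fin, of "\<lambda>n. max (g n) (g' n)" K]) (auto simp: D_def g)
  let ?B = "{n \<in> D. max (g n) (g' n) \<le> k}"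
  let ?A = "\<lambda>g. {n \<in> D. k \<le> g n}"
  have "{n \<in> D. k \<le> max (g n) (g' n)} = ?A g \<union> ?A g'"
    by auto
  with k(3) have "card D \<le> 2 * (card (?A g) + card (?A g'))"
    by (metis (no_types, lifting) card_Un_le le_trans mult_le_mono2)
  moreover have "d \<le> 4 * a \<or> d \<le> 4 * b" if "d \<le> 2 * (a + b)" for a b d :: nat
    using that by arith
  ultimately have "card D \<le> 4 * card (?A g) \<or> card D \<le> 4 * card (?A g')"
    by blast
  moreover have "(rel_dist j g g')\<^sup>2 \<le> 16 * rel_dist i (codeword j k g) (codeword j k g')"
    if i: "2 * j + k + 2 \<le> i" for i
  proof -
    define M where "M = mismatches i (codeword j k g) (codeword j k g')"
    define H where "H = (2::nat) ^ (i - 2 * j)"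
    have "card (?A g) * card ?B * H \<le> 2 * M"
      unfolding M_def H_def by (rule mismatches_codeword_ge[OF i]) (auto simp: D_def)
    moreover have "card (?A g') * card ?B * H \<le> 2 * M"
      unfolding M_def H_def mismatches_commute[of _ "codeword j k g"]
      by (rule mismatches_codeword_ge[OF i]) (auto simp: D_def)
    ultimately obtain a where a: "card D \<le> 4 * a" "a * card ?B * H \<le> 2 * M"
      using \<open>card D \<le> 4 * card (?A g) \<or> card D \<le> 4 * card (?A g')\<close> by blast
    have "card D * card D * H \<le> (4 * a) * (2 * card ?B) * H"
      using a(1) k(2) by (intro mult_mono) auto
    also have "\<dots> \<le> 16 * M"
      using mult_le_mono2[OF a(2), of 8] by (simp add: mult_ac)
    finally have "real (card D) * real (card D) * real H \<le> 16 * real M"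
      by (metis of_nat_le_iff of_nat_mult of_nat_numeral)
    moreover have "(2::nat) ^ i = 2 ^ j * 2 ^ j * H"
      using i by (simp add: H_def flip: power_add)
    then have "(2::real) ^ i = 2 ^ j * 2 ^ j * real H"
      by (metis of_nat_mult of_nat_numeral of_nat_power)
    moreover have "real H > 0"
      by (simp add: H_def)
    ultimately show ?thesis
      by (simp add: rel_dist_def mismatches_eq_card[of j] D_def[symmetric] M_def[symmetric]
          field_simps power2_eq_square)
  qed
  ultimately show thesis
    using that k(1) by blast
qed

section \<open>The encoding functional\<close>

text \<open>
  Block \<open>i\<close> of the code contains the record of block \<open>level i\<close> with threshold \<open>height i\<close>. With \<open>s\<close> the
  integer square root, \<open>(j, k) \<mapsto> s\<^sup>2 + j\<close> for \<open>s = j + k\<close> is an injective pairing; the numbers outside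
  its range merely produce further records. Each record is repeated in four blocks
  because of the division by \<open>4\<close>, which makes the blocks long enough: \<open>level i\<close> is at most \<open>i / 4\<close>.
\<close>

definition level :: "nat \<Rightarrow> nat" where
  "level i = i div 4 - (floor_sqrt (i div 4))\<^sup>2"

definition height :: "nat \<Rightarrow> nat" where
  "height i = floor_sqrt (i div 4) - level i"

text \<open>
  The last of the blocks assigned to \<open>(j, k)\<close>, and the one that decoding reads. The summand \<open>3\<close> is what
  leaves room for \<open>k + 2\<close> bits even when \<open>j = k = 0\<close>.
\<close>

definition index :: "nat \<Rightarrow> nat \<Rightarrow> nat" where
  "index j k = 4 * ((j + k)\<^sup>2 + j) + 3"

lemma index_div_4: "index j k div 4 = (j + k)\<^sup>2 + j"
  by (simp add: index_def)

lemma floor_sqrt_index: "floor_sqrt (index j k div 4) = j + k"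
  by (rule floor_sqrt_unique) (simp_all add: index_div_4 power2_eq_square)

lemma level_index [simp]: "level (index j k) = j"
  unfolding level_def floor_sqrt_index by (simp add: index_div_4)

lemma height_index [simp]: "height (index j k) = k"
  by (simp add: height_def floor_sqrt_index)

lemma index_ge: "2 * j + k + 2 \<le> index j k"
proof -
  have "j + k \<le> (j + k)\<^sup>2"
    unfolding power2_eq_square by (rule le_square)
  moreover have "2 * j + k + 2 \<le> 4 * (q + j) + 3" if "j + k \<le> q" for q
    using that by simp
  ultimately show ?thesis
    unfolding index_def by blast
qed

lemma level_le: "2 * level i \<le> i"
  by (simp add: level_def)

text \<open>
  Only finitely many blocks have bounded level and bounded height.
\<close>

lemma index_bounded: "i < 4 * (Suc (level i + height i))\<^sup>2"
proof -
  let ?s = "floor_sqrt (i div 4)"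
  have "i div 4 < (Suc ?s)\<^sup>2"
    by (rule Suc_floor_sqrt_power2_gt)
  also have "\<dots> \<le> (Suc (level i + height i))\<^sup>2"
    by (intro power_mono) (auto simp: height_def)
  finally show ?thesis by linarith
qed

definition encode :: "(nat \<Rightarrow> nat) \<Rightarrow> nat \<Rightarrow> nat" where
  "encode f x = (let i = floor_log (Suc x); j = level i
     in codeword j (height i) (block f j) (Suc x - 2 ^ i))"

lemma block_encode:
  assumes "z < 2 ^ i"
  shows "block (encode f) i z = codeword (level i) (height i) (block f (level i)) z"
  using floor_log_block[OF assms] by (simp add: block_def encode_def Let_def)

lemma encode_in_cantor: "encode f \<in> cantor"
  by (auto simp: cantor_def encode_def codeword_def Let_def)

lemma block_bounded: obtains M where "\<And>a. a < 2 ^ j \<Longrightarrow> block f j a < M"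
proof
  show "block f j a < Suc (\<Sum>a<2 ^ j. block f j a)" if "a < 2 ^ j" for a
    using that by (simp add: less_Suc_eq_le member_le_sum)
qed

text \<open>
  At high levels the two functions are close to each other on every block, and so are their records,
  uniformly in the height. At each of the finitely many low levels the records vanish once the
  height exceeds all values, which leaves only finitely many blocks.
\<close>

lemma coarse_description_encode:
  assumes "coarse_description g f"
  shows "coarse_description (encode g) (encode f)"
proof (rule coarse_description_if_rel_dist_block_tendsto_0, rule LIMSEQ_I)
  fix e :: real assume "e > 0"
  let ?d = "\<lambda>i. rel_dist i (block (encode f) i) (block (encode g) i)"
  obtain J where J: "\<And>j. j \<ge> J \<Longrightarrow> rel_dist j (block f j) (block g j) < e / 2"
    using LIMSEQ_D[OF rel_dist_block_tendsto_0[OF assms], of "e / 2"] \<open>e > 0\<close> by auto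
  define M where "M = Suc (\<Sum>x<2 ^ J. f x + g x)"
  have M: "f x < M" "g x < M" if "x < 2 ^ J" for x
    using member_le_sum[of x "{..<2 ^ J}" "\<lambda>x. f x + g x"] that by (auto simp: M_def)
  have "?d i < e" if i: "i \<ge> 4 * (Suc (J + M))\<^sup>2" for i
  proof -
    define j k where "j = level i" and "k = height i"
    have d: "?d i = rel_dist i (codeword j k (block f j)) (codeword j k (block g j))"
      by (rule rel_dist_cong) (simp_all add: block_encode j_def k_def)
    show ?thesis
    proof (cases "J \<le> j")
      case True
      then show ?thesis
        using J[of j] rel_dist_codeword_le[OF level_le, of i "height i" "block f j" "block g j"] d
        by (simp add: j_def k_def)
    next
      case False
      have "M \<le> k"
      proof (rule ccontr)
        assume "\<not> M \<le> k"
        with False have "(Suc (j + k))\<^sup>2 \<le> (Suc (J + M))\<^sup>2"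
          by (intro power_mono) auto
        with index_bounded[of i] i show False
          unfolding j_def k_def by linarith
      qed
      have less: "2 ^ j - 1 + a < 2 ^ J" if "a < 2 ^ j" for a :: nat
      proof -
        have "(2::nat) ^ Suc j \<le> 2 ^ J"
          using False by (intro power_increasing) auto
        with that show ?thesis by simp
      qed
      have "codeword j k (block f j) = (\<lambda>_. 0)" "codeword j k (block g j) = (\<lambda>_. 0)"
        using M[OF less] \<open>M \<le> k\<close>
        by (auto intro!: codeword_eq_0 simp: block_def intro: order.strict_trans2)
      then show ?thesis
        using d \<open>e > 0\<close> by (simp add: rel_dist_eq_0_iff[THEN iffD2])
    qed
  qed
  then show "\<exists>n. \<forall>i\<ge>n. norm (?d i - 0) < e"
    by (metis rel_dist_nonneg diff_zero real_norm_def abs_of_nonneg)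
qed

section \<open>The decoding functional\<close>

text \<open>
  Functions from \<open>{..<n}\<close> to \<open>{..<B}\<close> are represented by the digits to base \<open>B\<close> of the numbers below \<open>B ^ n\<close>.
\<close>

definition digit :: "nat \<Rightarrow> nat \<Rightarrow> nat \<Rightarrow> nat" where
  "digit B c a = c div B ^ a mod B"

lemma digits_exist:
  assumes "0 < B" "\<And>a. a < n \<Longrightarrow> g a < B"
  obtains c where "c < B ^ n" "\<And>a. a < n \<Longrightarrow> digit B c a = g a"
proof -
  have "\<exists>c<B ^ n. \<forall>a<n. digit B c a = g a"
    using assms(2)
  proof (induction n arbitrary: g)
    case 0
    then show ?case by simp
  next
    case (Suc n)
    obtain c where c: "c < B ^ n" "\<And>a. a < n \<Longrightarrow> digit B c a = g (Suc a)"
      using Suc.IH[of "\<lambda>a. g (Suc a)"] Suc.prems by auto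
    have g0: "g 0 < B"
      using Suc.prems by simp
    have "g 0 + B * c < B * Suc c"
      using g0 by simp
    also have "\<dots> \<le> B ^ Suc n"
      using c(1) by (simp only: power_Suc) (intro mult_le_mono, auto)
    finally have "g 0 + B * c < B ^ Suc n" .
    moreover have "digit B (g 0 + B * c) a = g a" if "a < Suc n" for a
      using c(2) g0 that assms(1) by (cases a) (auto simp: digit_def div_mult2_eq)
    ultimately show ?case by blast
  qed
  then show thesis
    using that by blast
qed

text \<open>
  Fewer than \<open>2 ^ index j K / 2 ^ (j + 1)\<close> ones. On an exact code this forces a record of zeros, since
  a single value that reaches \<open>K\<close> produces that many ones; on a corrupted one it still
  leaves only a vanishing fraction of such values as \<open>j\<close> grows.
\<close>

definition settled :: "(nat \<Rightarrow> nat) \<Rightarrow> nat \<Rightarrow> nat \<Rightarrow> bool" where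
  "settled X j K \<longleftrightarrow>
     2 ^ Suc j * mismatches (index j K) (block X (index j K)) (\<lambda>_. 0) < 2 ^ index j K"

text \<open>
  The number \<open>E\<close> encodes a pair: its quotient \<open>d\<close> by \<open>B = Suc K ^ 2 ^ j\<close> is an error bound in units of
  \<open>1 / 2 ^ j\<close>, and its remainder a function with values at most \<open>K\<close>, all of whose records up to \<open>K\<close> have
  to be within the bound. As the bound is the more significant component, the least such \<open>E\<close>
  minimises the largest error, up to rounding. The rounding is negligible for large \<open>j\<close>, and the
  error bound \<open>0\<close> demands an exact match.
\<close>

definition fits :: "(nat \<Rightarrow> nat) \<Rightarrow> nat \<Rightarrow> nat \<Rightarrow> nat \<Rightarrow> bool" where
  "fits X j K E \<longleftrightarrow> (\<forall>k<Suc K.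
     2 ^ j * mismatches (index j k) (block X (index j k))
       (codeword j k (digit (Suc K) (E mod Suc K ^ 2 ^ j)))
     \<le> E div Suc K ^ 2 ^ j * 2 ^ index j k)"

definition nearest :: "(nat \<Rightarrow> nat) \<Rightarrow> nat \<Rightarrow> nat \<Rightarrow> nat \<Rightarrow> nat" where
  "nearest X j K = digit (Suc K) ((LEAST E. fits X j K E) mod Suc K ^ 2 ^ j)"

lemma nearest_le: "nearest X j K a \<le> K"
  by (simp add: nearest_def digit_def flip: less_Suc_eq_le)

lemma fits_exists: "\<exists>E. fits X j K E"
proof
  show "fits X j K (2 ^ j * Suc K ^ 2 ^ j)"
    by (simp add: fits_def mismatches_le del: power_Suc)
qed

text \<open>
  Optimality of \<open>nearest X j K\<close>: it is as good as any competitor \<open>g\<close>.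
\<close>

lemma rel_dist_nearest:
  assumes g: "\<And>a. a < 2 ^ j \<Longrightarrow> g a \<le> K"
    and d: "\<And>k. k \<le> K \<Longrightarrow> rel_dist (index j k) (block X (index j k)) (codeword j k g) \<le> real d / 2 ^ j"
    and k: "k \<le> K"
  shows "rel_dist (index j k) (block X (index j k)) (codeword j k (nearest X j K)) \<le> real d / 2 ^ j"
proof -
  have scale: "rel_dist i u v \<le> real d / 2 ^ j \<longleftrightarrow> 2 ^ j * mismatches i u v \<le> d * 2 ^ i" for i u v d
  proof -
    have "rel_dist i u v \<le> real d / 2 ^ j \<longleftrightarrow> real (2 ^ j * mismatches i u v) \<le> real (d * 2 ^ i)"
      by (simp add: rel_dist_def field_simps)
    then show ?thesis
      by (simp only: of_nat_le_iff)
  qed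
  let ?B = "Suc K ^ 2 ^ j"
  obtain c where c: "c < ?B" "\<And>a. a < 2 ^ j \<Longrightarrow> digit (Suc K) c a = g a"
    using digits_exist[of "Suc K" "2 ^ j" g] g by (auto simp: less_Suc_eq_le)
  have "codeword j k (digit (Suc K) c) = codeword j k g" for k
    by (simp add: codeword_def fun_eq_iff c(2))
  then have "fits X j K (d * ?B + c)"
    using d c(1) by (simp add: fits_def less_Suc_eq_le scale)
  then have "(LEAST E. fits X j K E) \<le> d * ?B + c"
    by (rule Least_le)
  then have "(LEAST E. fits X j K E) div ?B \<le> (d * ?B + c) div ?B"
    by (rule div_le_mono)
  also have "\<dots> = d"
    using c(1) by simp
  finally have le: "(LEAST E. fits X j K E) div ?B \<le> d" .
  have "fits X j K (LEAST E. fits X j K E)"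
    using fits_exists by (rule LeastI_ex)
  then have "2 ^ j * mismatches (index j k) (block X (index j k)) (codeword j k (nearest X j K))
      \<le> (LEAST E. fits X j K E) div ?B * 2 ^ index j k"
    using k by (simp add: fits_def nearest_def less_Suc_eq_le)
  also have "\<dots> \<le> d * 2 ^ index j k"
    using le by simp
  finally show ?thesis
    by (simp add: scale)
qed

lemma settled_iff:
  "settled X j K \<longleftrightarrow> rel_dist (index j K) (block X (index j K)) (\<lambda>_. 0) < 1 / 2 / 2 ^ j"
proof -
  have "rel_dist i u v < 1 / 2 / 2 ^ j \<longleftrightarrow> real (2 ^ Suc j * mismatches i u v) < real (2 ^ i)" for i u v
    by (simp add: rel_dist_def field_simps)
  then show ?thesis
    by (simp only: settled_def of_nat_less_iff)
qed

lemma settled_truncation: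
  assumes "settled X j K"
    and "rel_dist (index j K) (block X (index j K)) (codeword j K f) \<le> d"
  shows "real (card {a. a < 2 ^ j \<and> K \<le> f a}) / 2 ^ j < 2 * d + 1 / 2 ^ j"
proof -
  have "real (card {a. a < 2 ^ j \<and> K \<le> f a}) / 2 ^ j \<le> 2 * rel_dist (index j K) (codeword j K f) (\<lambda>_. 0)"
    by (rule ones_codeword_ge[OF index_ge])
  also have "\<dots> \<le> 2 * (d + rel_dist (index j K) (block X (index j K)) (\<lambda>_. 0))"
    using rel_dist_triangle[of "index j K" "codeword j K f" "\<lambda>_. 0" "block X (index j K)"] assms(2)
    by (simp add: rel_dist_commute)
  also have "\<dots> < 2 * d + 1 / 2 ^ j"
    using assms(1) by (simp add: settled_iff)
  finally show ?thesis .
qed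

text \<open>
  Without errors all values are below \<open>K\<close>, hence \<open>f\<close> itself is a competitor with error bound \<open>0\<close>; so the
  winner has the same records as \<open>f\<close>, and these determine it.
\<close>

lemma nearest_exact:
  assumes "settled X j K"
    and X: "\<And>k. rel_dist (index j k) (block X (index j k)) (codeword j k f) = 0"
    and a: "a < 2 ^ j"
  shows "nearest X j K a = f a"
proof -
  have "real (card {a. a < 2 ^ j \<and> K \<le> f a}) / 2 ^ j < 1 / 2 ^ j"
    using settled_truncation[OF assms(1), of f 0] X by simp
  then have "card {a. a < 2 ^ j \<and> K \<le> f a} = 0"
    by (simp add: divide_less_cancel)
  then have f: "f a \<le> K" if "a < 2 ^ j" for a
    using that by (auto simp: not_le)
  obtain k where "k \<le> K" and k: "(rel_dist j f (nearest X j K))\<^sup>2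
      \<le> 16 * rel_dist (index j k) (codeword j k f) (codeword j k (nearest X j K))"
    by (rule codeword_separation[of j f K "nearest X j K"]) (use f nearest_le index_ge in blast)+
  have "rel_dist (index j k) (block X (index j k)) (codeword j k (nearest X j K)) \<le> 0"
    using rel_dist_nearest[OF f _ \<open>k \<le> K\<close>, where d = 0 and X = X] X by simp
  moreover have "rel_dist (index j k) (codeword j k f) (block X (index j k)) = 0"
    using X[of k] by (simp only: rel_dist_commute)
  ultimately have "(rel_dist j f (nearest X j K))\<^sup>2 \<le> 0"
    using k rel_dist_triangle[of "index j k" "codeword j k f" "codeword j k (nearest X j K)" "block X (index j k)"]
    by linarith
  then show ?thesis
    using a by (simp add: rel_dist_eq_0_iff)
qed

text \<open>
  The competitor is \<open>f\<close> truncated at \<open>K\<close>. It differs from \<open>f\<close> in a fraction of at most \<open>3 * d\<close> of the block,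
  so its records are within \<open>d + 2 * (3 * d) = 7 * d\<close> of \<open>X\<close>, those of the winner within \<open>8 * d\<close> after
  rounding, and the two are within \<open>15 * d\<close> of each other; separation turns this into a
  distance of at most \<open>sqrt (16 * 15 * d)\<close>.
\<close>

lemma nearest_approx:
  assumes "settled X j K"
    and X: "\<And>k. rel_dist (index j k) (block X (index j k)) (codeword j k f) \<le> d"
    and j: "1 / 2 ^ j \<le> d"
  shows "rel_dist j f (nearest X j K) \<le> sqrt (240 * d) + 3 * d"
proof -
  define g where "g a = min (f a) K" for a
  have g: "g a \<le> K" for a
    by (simp add: g_def)
  have "rel_dist j f g \<le> real (card {a. a < 2 ^ j \<and> K \<le> f a}) / 2 ^ j"
    unfolding rel_dist_def mismatches_eq_card
    by (intro divide_right_mono of_nat_mono card_mono) (auto simp: g_def)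
  also have "\<dots> \<le> 3 * d"
    using settled_truncation[OF assms(1) X] j by simp
  finally have fg: "rel_dist j f g \<le> 3 * d" .
  have Xg: "rel_dist (index j k) (block X (index j k)) (codeword j k g) \<le> 7 * d" for k
  proof -
    have "2 * j \<le> index j k"
      using index_ge[of j k] by simp
    from rel_dist_codeword_le[OF this, of k f g]
    show ?thesis
      using rel_dist_triangle[of "index j k" "block X (index j k)" "codeword j k g" "codeword j k f"]
        X[of k] fg by simp
  qed
  define n where "n = nat \<lceil>7 * d * 2 ^ j\<rceil>"
  have "0 < d"
    using j less_le_trans[of 0 "1 / 2 ^ j" d] by simp
  then have "7 * d * 2 ^ j \<le> real n" "real n \<le> 7 * d * 2 ^ j + 1"
    unfolding n_def by (simp_all add: of_nat_nat)
  then have "7 * d \<le> real n / 2 ^ j" "real n / 2 ^ j \<le> 7 * d + 1 / 2 ^ j"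
    by (simp_all add: field_simps)
  then have n: "7 * d \<le> real n / 2 ^ j" "real n / 2 ^ j \<le> 8 * d"
    using j by simp_all
  obtain k where "k \<le> K" and k: "(rel_dist j g (nearest X j K))\<^sup>2
      \<le> 16 * rel_dist (index j k) (codeword j k g) (codeword j k (nearest X j K))"
    by (rule codeword_separation[of j g K "nearest X j K"]) (use g nearest_le index_ge in blast)+
  have "rel_dist (index j k) (block X (index j k)) (codeword j k (nearest X j K)) \<le> real n / 2 ^ j"
    using rel_dist_nearest[of j g K X n k] g Xg n(1) \<open>k \<le> K\<close> order_trans by blast
  then have "(rel_dist j g (nearest X j K))\<^sup>2 \<le> 240 * d"
    using k n(2) Xg[of k]
      rel_dist_triangle[of "index j k" "codeword j k g" "codeword j k (nearest X j K)" "block X (index j k)"]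
    by (simp add: rel_dist_commute)
  then have "rel_dist j g (nearest X j K) \<le> sqrt (240 * d)"
    by (rule real_le_rsqrt)
  then show ?thesis
    using rel_dist_triangle[of j f "nearest X j K" g] fg by simp
qed

definition decode :: "(nat \<Rightarrow> nat) \<Rightarrow> nat \<Rightarrow> nat" where
  "decode X x = (let j = floor_log (Suc x)
     in nearest X j (LEAST K. settled X j K) (Suc x - 2 ^ j))"

lemma block_decode:
  assumes "a < 2 ^ j"
  shows "block (decode X) j a = nearest X j (LEAST K. settled X j K) a"
  using floor_log_block[OF assms] by (simp add: block_def decode_def Let_def)

lemma rel_dist_block_encode:
  "rel_dist (index j k) (block X (index j k)) (codeword j k (block f j))
    = rel_dist (index j k) (block (encode f) (index j k)) (block X (index j k))"
  unfolding rel_dist_commute[of _ "block X _"] by (rule rel_dist_cong) (simp_all add: block_encode)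

text \<open>
  Once \<open>K\<close> exceeds all values of \<open>f\<close> on block \<open>j\<close>, the records are zero, and the fraction of errors in
  \<open>X\<close> tends to \<open>0\<close> as \<open>K\<close> grows with \<open>j\<close> fixed. So decoding terminates for every coarse description, no
  matter how wrong \<open>X\<close> is at small indices.
\<close>

lemma settled_exists:
  assumes "coarse_description X (encode f)"
  shows "\<exists>K. settled X j K"
proof -
  obtain I where I: "\<And>i. i \<ge> I \<Longrightarrow> rel_dist i (block (encode f) i) (block X i) < 1 / 2 / 2 ^ j"
    using LIMSEQ_D[OF rel_dist_block_tendsto_0[OF assms], of "1 / 2 / 2 ^ j"] by auto
  obtain M where M: "\<And>a. a < 2 ^ j \<Longrightarrow> block f j a < M"
    using block_bounded by blast
  define K where "K = max I M"
  have "index j K \<ge> I"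
    using index_ge[of j K] by (simp add: K_def)
  from I[OF this] have "rel_dist (index j K) (block X (index j K)) (codeword j K (block f j)) < 1 / 2 / 2 ^ j"
    by (simp only: rel_dist_block_encode)
  moreover have "codeword j K (block f j) = (\<lambda>_. 0)"
    by (rule codeword_eq_0) (use M in \<open>auto simp: K_def less_max_iff_disj\<close>)
  ultimately have "settled X j K"
    by (simp add: settled_iff)
  then show ?thesis ..
qed

lemma decode_encode: "decode (encode f) = f"
proof
  fix x
  define j where "j = floor_log (Suc x)"
  define a where "a = Suc x - 2 ^ j"
  have le: "2 ^ j \<le> Suc x" and gt: "Suc x < 2 * 2 ^ j"
    unfolding j_def by (rule floor_log_exp2_le, simp, rule floor_log_exp2_gt)
  have x: "x = 2 ^ j - 1 + a" and a: "a < 2 ^ j"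
    using le gt by (auto simp: a_def)
  have "coarse_description (encode f) (encode f)"
    by (simp add: coarse_description_def density_zero_def)
  then have "settled (encode f) j (LEAST K. settled (encode f) j K)"
    by (rule LeastI_ex[OF settled_exists])
  then have "block (decode (encode f)) j a = block f j a"
    unfolding block_decode[OF a]
    by (rule nearest_exact) (auto simp: a rel_dist_block_encode rel_dist_eq_0_iff)
  then show "decode (encode f) x = f x"
    by (simp add: block_def x)
qed

lemma coarse_description_decode:
  assumes "coarse_description X (encode f)"
  shows "coarse_description (decode X) f"
proof (rule coarse_description_if_rel_dist_block_tendsto_0, rule LIMSEQ_I)
  fix e :: real assume "e > 0"
  \<comment> \<open>Chosen such that \<open>sqrt (240 * d) \<le> e / 2\<close> and \<open>3 * d < e / 2\<close>.\<close>
  define d where "d = min (e\<^sup>2 / 960) (e / 7)"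
  have d: "d > 0" "960 * d \<le> e\<^sup>2" "7 * d \<le> e"
    using \<open>e > 0\<close> by (auto simp: d_def)
  have "sqrt (240 * d) \<le> e / 2"
    by (rule real_le_lsqrt) (use d \<open>e > 0\<close> in \<open>auto simp: power_divide\<close>)
  then have less_e: "sqrt (240 * d) + 3 * d < e"
    using d by linarith
  obtain I where I: "\<And>i. i \<ge> I \<Longrightarrow> rel_dist i (block (encode f) i) (block X i) < d"
    using LIMSEQ_D[OF rel_dist_block_tendsto_0[OF assms], of d] d(1) by auto
  obtain J where J: "(1 / 2) ^ J < d"
    using real_arch_pow_inv[of d "1 / 2"] d(1) by auto
  have "rel_dist j (block f j) (block (decode X) j) < e" if j: "j \<ge> max I J" for j
  proof -
    have "(1 / 2 :: real) ^ j \<le> (1 / 2) ^ J"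
      using j by (intro power_decreasing) auto
    with J have "1 / 2 ^ j \<le> d"
      by (simp add: power_divide)
    moreover have "rel_dist (index j k) (block X (index j k)) (codeword j k (block f j)) \<le> d" for k
      using I[of "index j k"] index_ge[of j k] j by (simp add: rel_dist_block_encode)
    moreover have "settled X j (LEAST K. settled X j K)"
      using settled_exists[OF assms] by (rule LeastI_ex)
    ultimately have "rel_dist j (block f j) (nearest X j (LEAST K. settled X j K)) \<le> sqrt (240 * d) + 3 * d"
      by (intro nearest_approx)
    also have "rel_dist j (block f j) (nearest X j (LEAST K. settled X j K))
        = rel_dist j (block f j) (block (decode X) j)"
      by (rule rel_dist_cong) (simp_all add: block_decode)
    finally show ?thesis
      using less_e by simp
  qed
  then show "\<exists>n. \<forall>j\<ge>n. norm (rel_dist j (block f j) (block (decode X) j) - 0) < e"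
    by (intro exI[of _ "max I J"]) simp
qed

section \<open>Functions computable relative to an oracle\<close>

text \<open>
  Only total operations of a fixed arity, uniformly in the oracle \<open>f\<close>: for these, closure under the usual
  arithmetical and logical constructions can be stated as introduction rules that apply to terms
  as they are written. Predicates enter through their characteristic functions \<open>of_bool\<close>.
\<close>

definition computable_op :: "nat \<Rightarrow> ((nat \<Rightarrow> nat) \<Rightarrow> nat list \<Rightarrow> nat) \<Rightarrow> bool" where
  "computable_op n F \<longleftrightarrow> (\<exists>p. \<forall>f xs. length xs = n \<longrightarrow> computes f p xs (F f xs))"

named_theorems computable_intros

lemma computable_op_cong:
  assumes "computable_op n F" and "\<And>f xs. length xs = n \<Longrightarrow> F f xs = G f xs"
  shows "computable_op n G"
  using assms unfolding computable_op_def by metis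

lemma computable_op_Comp:
  assumes F: "computable_op k F" and Gs: "\<And>i. i < k \<Longrightarrow> computable_op n (G i)"
  shows "computable_op n (\<lambda>f xs. F f (map (\<lambda>i. G i f xs) [0..<k]))"
proof -
  obtain p where p: "\<And>f xs. length xs = k \<Longrightarrow> computes f p xs (F f xs)"
    using F unfolding computable_op_def by blast
  have "\<forall>i. \<exists>q. i < k \<longrightarrow> (\<forall>f xs. length xs = n \<longrightarrow> computes f q xs (G i f xs))"
    using Gs unfolding computable_op_def by blast
  then obtain q where q: "\<And>i f xs. i < k \<Longrightarrow> length xs = n \<Longrightarrow> computes f (q i) xs (G i f xs)"
    by metis
  have "computes f (Comp p (map q [0..<k])) xs (F f (map (\<lambda>i. G i f xs) [0..<k]))"
    if "length xs = n" for f xs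
    by (rule computes.comp[where ys = "map (\<lambda>i. G i f xs) [0..<k]"])
       (use that p q in \<open>auto simp: list_all2_conv_all_nth\<close>)
  then show ?thesis
    unfolding computable_op_def by blast
qed

lemma computable_op_nth [computable_intros]: "i < n \<Longrightarrow> computable_op n (\<lambda>f xs. xs ! i)"
  unfolding computable_op_def by (metis computes.proj)

text \<open>
  Under a bounded sum, a bounded quantifier or a minimum, the bound variable is prepended to the
  argument list. Hence the body refers to it by \<open>hd\<close>, and to the outer arguments through \<open>tl\<close>.
\<close>

lemma computable_op_hd [computable_intros]: "0 < n \<Longrightarrow> computable_op n (\<lambda>f xs. hd xs)"
  by (rule computable_op_cong[OF computable_op_nth[of 0]]) (auto simp: hd_conv_nth)

lemma computable_op_nth_tl [computable_intros]:
  "Suc i < n \<Longrightarrow> computable_op n (\<lambda>f xs. tl xs ! i)"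
  by (rule computable_op_cong[OF computable_op_nth[of "Suc i"]]) (auto simp: nth_tl)

lemma computable_op_hd_tl [computable_intros]:
  "Suc 0 < n \<Longrightarrow> computable_op n (\<lambda>f xs. hd (tl xs))"
  by (rule computable_op_cong[OF computable_op_nth[of "Suc 0"]])
     (auto simp: length_Suc_conv Suc_less_eq2 elim!: less_natE)

lemma computable_op_nth_tl_tl [computable_intros]:
  "Suc (Suc i) < n \<Longrightarrow> computable_op n (\<lambda>f xs. tl (tl xs) ! i)"
  by (rule computable_op_cong[OF computable_op_nth[of "Suc (Suc i)"]]) (auto simp: nth_tl)

lemma computable_op_compose1:
  assumes "computable_op 1 (\<lambda>f xs. G f (xs ! 0))" "computable_op n F"
  shows "computable_op n (\<lambda>f xs. G f (F f xs))"
  using computable_op_Comp[OF assms(1), where G = "\<lambda>_. F" and n = n] assms(2) by simp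

lemma computable_op_Suc [computable_intros]:
  assumes "computable_op n F"
  shows "computable_op n (\<lambda>f xs. Suc (F f xs))"
proof (rule computable_op_compose1[OF _ assms])
  show "computable_op 1 (\<lambda>f xs. Suc (xs ! 0))"
    unfolding computable_op_def
    by (rule exI[of _ Succ]) (auto simp: length_Suc_conv intro: computes.succ)
qed

lemma computable_op_Query [computable_intros]:
  assumes "computable_op n F"
  shows "computable_op n (\<lambda>f xs. f (F f xs))"
proof (rule computable_op_compose1[OF _ assms])
  show "computable_op 1 (\<lambda>f xs. f (xs ! 0))"
    unfolding computable_op_def
    by (rule exI[of _ Query]) (auto simp: length_Suc_conv intro: computes.query)
qed

lemma computable_op_0 [computable_intros]: "computable_op n (\<lambda>f xs. 0)"
  unfolding computable_op_def by (metis computes.zero)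

lemma computable_op_const [computable_intros]: "computable_op n (\<lambda>f xs. c)"
  by (induction c) (auto intro: computable_intros)

lemma computable_op_rec_nat:
  assumes N: "computable_op n N" and B: "computable_op n B"
    and S: "computable_op (Suc (Suc n)) (\<lambda>f ys. S f (tl (tl ys)) (hd ys) (hd (tl ys)))"
  shows "computable_op n (\<lambda>f xs. rec_nat (B f xs) (S f xs) (N f xs))"
proof -
  obtain b where b: "\<And>f xs. length xs = n \<Longrightarrow> computes f b xs (B f xs)"
    using B unfolding computable_op_def by blast
  obtain s where "\<And>f xs. length xs = Suc (Suc n) \<Longrightarrow>
      computes f s xs (S f (tl (tl xs)) (hd xs) (hd (tl xs)))"
    using S unfolding computable_op_def by blast
  from this[of "_ # _ # _"] have s: "\<And>f m r xs. length xs = n \<Longrightarrow> computes f s (m # r # xs) (S f xs m r)"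
    by simp
  have "computes f (PrimRec b s) (m # xs) (rec_nat (B f xs) (S f xs) m)" if "length xs = n" for f xs m
    by (induction m) (use that b s in \<open>auto intro: computes.intros\<close>)
  then have "computable_op (Suc n) (\<lambda>f ys. rec_nat (B f (tl ys)) (S f (tl ys)) (hd ys))"
    unfolding computable_op_def by (intro exI[of _ "PrimRec b s"]) (auto simp: length_Suc_conv)
  from computable_op_Comp[OF this, where n = n and G = "\<lambda>i. if i = 0 then N else (\<lambda>f xs. xs ! (i - 1))"]
  have "computable_op n (\<lambda>f xs. rec_nat (B f (map (\<lambda>i. xs ! i) [0..<n]))
     (S f (map (\<lambda>i. xs ! i) [0..<n])) (N f xs))"
    using N by (simp add: upt_conv_Cons map_Suc_upt[symmetric] comp_def computable_op_nth del: upt_Suc)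
  then show ?thesis
    by (rule computable_op_cong) (auto simp: map_nth)
qed

lemma computable_op_add [computable_intros]:
  assumes "computable_op n F" "computable_op n G"
  shows "computable_op n (\<lambda>f xs. F f xs + G f xs)"
proof (rule computable_op_cong)
  show "computable_op n (\<lambda>f xs. rec_nat (G f xs) (\<lambda>m r. Suc r) (F f xs))"
    by (intro computable_op_rec_nat assms computable_intros) simp
  have "rec_nat b (\<lambda>m r. Suc r) a = a + b" for a b :: nat
    by (induction a) simp_all
  then show "rec_nat (G f xs) (\<lambda>m r. Suc r) (F f xs) = F f xs + G f xs" for f xs
    by simp
qed

text \<open>
  Weakening: adds a dummy argument, as is needed to move an operation under a binder.
\<close>

lemma computable_op_tl:
  assumes "computable_op n F"
  shows "computable_op (Suc n) (\<lambda>f ys. F f (tl ys))"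
proof (rule computable_op_cong)
  show "computable_op (Suc n) (\<lambda>f ys. F f (map (\<lambda>i. tl ys ! i) [0..<n]))"
    by (rule computable_op_Comp[OF assms]) (simp add: computable_op_nth_tl)
  show "F f (map (\<lambda>i. tl ys ! i) [0..<n]) = F f (tl ys)" if "length ys = Suc n" for f ys
  proof -
    have "map (\<lambda>i. tl ys ! i) [0..<n] = tl ys"
      using that by (intro nth_equalityI) auto
    then show ?thesis by simp
  qed
qed

lemma computable_op_mult [computable_intros]:
  assumes "computable_op n F" "computable_op n G"
  shows "computable_op n (\<lambda>f xs. F f xs * G f xs)"
proof (rule computable_op_cong)
  show "computable_op n (\<lambda>f xs. rec_nat 0 (\<lambda>m r. G f xs + r) (F f xs))"
    by (intro computable_op_rec_nat assms computable_intros
        computable_op_tl[OF computable_op_tl[OF assms(2)]]) simp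
  have "rec_nat 0 (\<lambda>m r. b + r) a = a * b" for a b :: nat
    by (induction a) simp_all
  then show "rec_nat 0 (\<lambda>m r. G f xs + r) (F f xs) = F f xs * G f xs" for f xs
    by simp
qed

lemma computable_op_power [computable_intros]:
  assumes "computable_op n F" "computable_op n G"
  shows "computable_op n (\<lambda>f xs. F f xs ^ G f xs)"
proof (rule computable_op_cong)
  show "computable_op n (\<lambda>f xs. rec_nat 1 (\<lambda>m r. F f xs * r) (G f xs))"
    by (intro computable_op_rec_nat assms computable_intros
        computable_op_tl[OF computable_op_tl[OF assms(1)]]) simp
  have "rec_nat 1 (\<lambda>m r. b * r) a = b ^ a" for a b :: nat
    by (induction a) simp_all
  then show "rec_nat 1 (\<lambda>m r. F f xs * r) (G f xs) = F f xs ^ G f xs" for f xs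
    by simp
qed

lemma computable_op_diff [computable_intros]:
  assumes "computable_op n F" "computable_op n G"
  shows "computable_op n (\<lambda>f xs. F f xs - G f xs)"
proof (rule computable_op_cong)
  show "computable_op n (\<lambda>f xs. rec_nat (F f xs) (\<lambda>m r. rec_nat 0 (\<lambda>k s. k) r) (G f xs))"
    by (intro computable_op_rec_nat assms computable_intros) simp_all
  have pred: "rec_nat 0 (\<lambda>k s. k) r = r - 1" for r :: nat
    by (cases r) simp_all
  have "rec_nat a (\<lambda>m r. rec_nat 0 (\<lambda>k s. k) r) b = a - b" for a b :: nat
    by (induction b) (simp_all add: pred)
  then show "rec_nat (F f xs) (\<lambda>m r. rec_nat 0 (\<lambda>k s. k) r) (G f xs) = F f xs - G f xs" for f xs
    by simp
qed

lemma computable_op_le [computable_intros]: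
  assumes "computable_op n F" "computable_op n G"
  shows "computable_op n (\<lambda>f xs. of_bool (F f xs \<le> G f xs))"
proof (rule computable_op_cong)
  show "computable_op n (\<lambda>f xs. 1 - (F f xs - G f xs))"
    by (intro assms computable_intros)
qed auto

lemma computable_op_less [computable_intros]:
  assumes "computable_op n F" "computable_op n G"
  shows "computable_op n (\<lambda>f xs. of_bool (F f xs < G f xs))"
proof (rule computable_op_cong)
  show "computable_op n (\<lambda>f xs. of_bool (Suc (F f xs) \<le> G f xs))"
    by (intro assms computable_intros)
qed (auto simp: Suc_le_eq)

lemma computable_op_not [computable_intros]:
  assumes "computable_op n (\<lambda>f xs. of_bool (P f xs))"
  shows "computable_op n (\<lambda>f xs. of_bool (\<not> P f xs))"
proof (rule computable_op_cong)
  show "computable_op n (\<lambda>f xs. 1 - of_bool (P f xs))"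
    by (intro assms computable_intros)
qed auto

lemma computable_op_conj [computable_intros]:
  assumes "computable_op n (\<lambda>f xs. of_bool (P f xs))" "computable_op n (\<lambda>f xs. of_bool (Q f xs))"
  shows "computable_op n (\<lambda>f xs. of_bool (P f xs \<and> Q f xs))"
proof (rule computable_op_cong)
  show "computable_op n (\<lambda>f xs. of_bool (P f xs) * of_bool (Q f xs))"
    by (intro assms computable_intros)
qed auto

lemma computable_op_eq [computable_intros]:
  assumes "computable_op n F" "computable_op n G"
  shows "computable_op n (\<lambda>f xs. of_bool (F f xs = G f xs))"
proof (rule computable_op_cong)
  show "computable_op n (\<lambda>f xs. of_bool (F f xs \<le> G f xs \<and> G f xs \<le> F f xs))"
    by (intro assms computable_intros)
qed auto

lemma computable_op_If [computable_intros]: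
  assumes "computable_op n (\<lambda>f xs. of_bool (P f xs))" "computable_op n F" "computable_op n G"
  shows "computable_op n (\<lambda>f xs. if P f xs then F f xs else G f xs)"
proof (rule computable_op_cong)
  show "computable_op n (\<lambda>f xs. of_bool (P f xs) * F f xs + of_bool (\<not> P f xs) * G f xs)"
    by (intro assms computable_intros)
qed auto

lemma computable_op_min [computable_intros]:
  assumes "computable_op n F" "computable_op n G"
  shows "computable_op n (\<lambda>f xs. min (F f xs) (G f xs))"
  unfolding min_def by (intro assms computable_intros)

lemma computable_op_sum [computable_intros]:
  assumes N: "computable_op n N" and T: "computable_op (Suc n) (\<lambda>f ys. T f (tl ys) (hd ys))"
  shows "computable_op n (\<lambda>f xs. \<Sum>z<N f xs. T f xs z)"
proof (rule computable_op_cong)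
  have "computable_op (Suc (Suc n))
    (\<lambda>f ys. T f (tl (map (\<lambda>i. ys ! (if i = 0 then 0 else Suc i)) [0..<Suc n]))
      (hd (map (\<lambda>i. ys ! (if i = 0 then 0 else Suc i)) [0..<Suc n])))"
    by (rule computable_op_Comp[OF T]) (simp add: computable_op_nth)
  then have T': "computable_op (Suc (Suc n)) (\<lambda>f ys. T f (tl (tl ys)) (hd ys))"
  proof (rule computable_op_cong)
    fix f :: "nat \<Rightarrow> nat" and ys :: "nat list" assume l: "length ys = Suc (Suc n)"
    have "map (\<lambda>i. ys ! (if i = 0 then 0 else Suc i)) [0..<Suc n] = hd ys # tl (tl ys)"
      using l by (intro nth_equalityI)
        (auto simp: nth_Cons length_Suc_conv simp del: upt_Suc split: nat.split)
    then show "T f (tl (map (\<lambda>i. ys ! (if i = 0 then 0 else Suc i)) [0..<Suc n]))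
        (hd (map (\<lambda>i. ys ! (if i = 0 then 0 else Suc i)) [0..<Suc n])) = T f (tl (tl ys)) (hd ys)"
      by simp
  qed
  show "computable_op n (\<lambda>f xs. rec_nat 0 (\<lambda>m r. r + T f xs m) (N f xs))"
    by (intro computable_op_rec_nat N computable_intros T') simp
  have "rec_nat 0 (\<lambda>m r. r + t m) k = (\<Sum>z<k. t z)" for t :: "nat \<Rightarrow> nat" and k
    by (induction k) simp_all
  then show "rec_nat 0 (\<lambda>m r. r + T f xs m) (N f xs) = (\<Sum>z<N f xs. T f xs z)" for f xs
    by simp
qed

lemma computable_op_all_less [computable_intros]:
  assumes "computable_op n N" "computable_op (Suc n) (\<lambda>f ys. of_bool (P f (tl ys) (hd ys)))"
  shows "computable_op n (\<lambda>f xs. of_bool (\<forall>z<N f xs. P f xs z))"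
proof (rule computable_op_cong)
  show "computable_op n (\<lambda>f xs. of_bool ((\<Sum>z<N f xs. of_bool (\<not> P f xs z)) = (0::nat)))"
    by (intro assms computable_intros)
qed auto

lemma computable_op_div [computable_intros]:
  assumes "computable_op n F" "computable_op n G"
  shows "computable_op n (\<lambda>f xs. F f xs div G f xs)"
proof (rule computable_op_cong)
  show "computable_op n (\<lambda>f xs. \<Sum>q<F f xs. of_bool (0 < G f xs \<and> Suc q * G f xs \<le> F f xs))"
    by (intro assms computable_intros computable_op_tl[OF assms(1)] computable_op_tl[OF assms(2)]) simp
  have "(\<Sum>q<a. of_bool (0 < b \<and> Suc q * b \<le> a)) = a div b" for a b :: nat
  proof (cases "b = 0")
    case False
    then have "Suc q * b \<le> a \<longleftrightarrow> q < a div b" for q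
      by (metis Suc_le_eq gr0I less_eq_div_iff_mult_less_eq)
    then have "(\<Sum>q<a. of_bool (0 < b \<and> Suc q * b \<le> a)) = card ({..<a} \<inter> {q. q < a div b})"
      using False by (simp add: sum_of_bool_eq)
    also have "{..<a} \<inter> {q. q < a div b} = {..<a div b}"
      by (auto intro: order.strict_trans2[OF _ div_le_dividend])
    finally show ?thesis by simp
  qed simp
  then show "(\<Sum>q<F f xs. of_bool (0 < G f xs \<and> Suc q * G f xs \<le> F f xs)) = F f xs div G f xs" for f xs .
qed

lemma computable_op_mod [computable_intros]:
  assumes "computable_op n F" "computable_op n G"
  shows "computable_op n (\<lambda>f xs. F f xs mod G f xs)"
proof (rule computable_op_cong)
  show "computable_op n (\<lambda>f xs. F f xs - (F f xs div G f xs) * G f xs)"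
    by (intro assms computable_intros)
qed (simp add: minus_div_mult_eq_mod)

text \<open>
  Stated for a single oracle and argument list, because decoding uses an unbounded search
  that terminates for some oracles only.
\<close>

lemma computes_Mu_Least:
  assumes "\<And>z. computes f p (z # xs) (of_bool (\<not> P z))" and "\<exists>z. P z"
  shows "computes f (Mu p) xs (LEAST z. P z)"
proof (rule computes.mu)
  have "P (LEAST z. P z)"
    using assms(2) by (rule LeastI_ex)
  then show "computes f p ((LEAST z. P z) # xs) 0"
    using assms(1)[of "LEAST z. P z"] by simp
  show "\<forall>m<LEAST z. P z. \<exists>v. computes f p (m # xs) (Suc v)"
    using assms(1) by (metis not_less_Least of_bool_eq(2) One_nat_def)
qed

lemma computable_op_Least [computable_intros]:
  assumes P: "computable_op (Suc n) (\<lambda>f ys. of_bool (P f (tl ys) (hd ys)))"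
    and ex: "\<And>f xs. \<exists>z. P f xs z"
  shows "computable_op n (\<lambda>f xs. LEAST z. P f xs z)"
proof -
  obtain p where "\<And>f ys. length ys = Suc n \<Longrightarrow> computes f p ys (of_bool (\<not> P f (tl ys) (hd ys)))"
    using computable_op_not[OF P] unfolding computable_op_def by blast
  from this[of "_ # _"] have "\<And>f z xs. length xs = n \<Longrightarrow> computes f p (z # xs) (of_bool (\<not> P f xs z))"
    by simp
  then have "\<forall>f xs. length xs = n \<longrightarrow> computes f (Mu p) xs (LEAST z. P f xs z)"
    using ex by (intro allI impI computes_Mu_Least)
  then show ?thesis
    unfolding computable_op_def by blast
qed

lemma computable_op_floor_sqrt [computable_intros]:
  assumes "computable_op n F"
  shows "computable_op n (\<lambda>f xs. floor_sqrt (F f xs))"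
proof (rule computable_op_cong)
  show "computable_op n (\<lambda>f xs. LEAST s. F f xs < Suc s ^ 2)"
  proof (intro computable_intros computable_op_tl[OF assms])
    show "\<exists>s. F f xs < Suc s ^ 2" for f xs
      using Suc_floor_sqrt_power2_gt by blast
  qed simp
  show "(LEAST s. F f xs < Suc s ^ 2) = floor_sqrt (F f xs)" for f xs
  proof (rule Least_equality)
    show "floor_sqrt (F f xs) \<le> s" if "F f xs < Suc s ^ 2" for s
      using that by (metis floor_sqrt_le_iff less_Suc_eq_le not_le le_floor_sqrt_iff)
  qed (rule Suc_floor_sqrt_power2_gt)
qed

lemma computable_op_floor_log [computable_intros]:
  assumes "computable_op n F"
  shows "computable_op n (\<lambda>f xs. floor_log (F f xs))"
proof (rule computable_op_cong)
  show "computable_op n (\<lambda>f xs. LEAST i. F f xs < 2 * 2 ^ i)"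
  proof (intro computable_intros computable_op_tl[OF assms])
    show "\<exists>i. F f xs < 2 * 2 ^ i" for f xs
      using floor_log_exp2_gt by blast
  qed simp
  show "(LEAST i. F f xs < 2 * 2 ^ i) = floor_log (F f xs)" for f xs
  proof (rule Least_equality)
    show "floor_log (F f xs) \<le> i" if "F f xs < 2 * 2 ^ i" for i
    proof (cases "F f xs = 0")
      case False
      then have "(2::nat) ^ floor_log (F f xs) < 2 ^ Suc i"
        using floor_log_exp2_le[of "F f xs"] that by simp
      then have "floor_log (F f xs) < Suc i"
        by (rule power_less_imp_less_exp[rotated]) simp
      then show ?thesis by simp
    qed simp
  qed (rule floor_log_exp2_gt)
qed

section \<open>Computability of encoding and decoding\<close>

lemma computable_op_compose2:
  assumes "computable_op 2 (\<lambda>f xs. G f (xs ! 0) (xs ! 1))" "computable_op n F1" "computable_op n F2"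
  shows "computable_op n (\<lambda>f xs. G f (F1 f xs) (F2 f xs))"
proof -
  have "computable_op n ([F1, F2] ! i)" if "i < 2" for i
    using that assms(2,3) by (auto simp: numeral_2_eq_2 less_Suc_eq_0_disj)
  from computable_op_Comp[OF assms(1), where G = "\<lambda>i. [F1, F2] ! i", OF this]
  show ?thesis
    by (simp add: numeral_2_eq_2)
qed

lemma computable_op_compose3:
  assumes "computable_op 3 (\<lambda>f xs. G f (xs ! 0) (xs ! 1) (xs ! 2))"
    "computable_op n F1" "computable_op n F2" "computable_op n F3"
  shows "computable_op n (\<lambda>f xs. G f (F1 f xs) (F2 f xs) (F3 f xs))"
proof -
  have "computable_op n ([F1, F2, F3] ! i)" if "i < 3" for i
    using that assms(2-4) by (auto simp: numeral_3_eq_3 less_Suc_eq_0_disj)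
  from computable_op_Comp[OF assms(1), where G = "\<lambda>i. [F1, F2, F3] ! i", OF this]
  show ?thesis
    by (simp add: numeral_3_eq_3 numeral_2_eq_2)
qed

lemma computable_op_encode: "computable_op 1 (\<lambda>f xs. encode f (xs ! 0))"
  unfolding encode_def Let_def codeword_def block_def level_def height_def
  by (intro computable_intros) simp_all

lemma computable_op_settled: "computable_op 2 (\<lambda>X xs. of_bool (settled X (xs ! 0) (xs ! 1)))"
  unfolding settled_def mismatches_def index_def block_def
  by (intro computable_intros) simp_all

lemma computable_op_fits:
  "computable_op 3 (\<lambda>X xs. of_bool (fits X (xs ! 0) (xs ! 1) (xs ! 2)))"
  unfolding fits_def mismatches_def index_def block_def codeword_def digit_def
  by (intro computable_intros) simp_all

lemma computable_op_nearest:
  "computable_op 3 (\<lambda>X xs. nearest X (xs ! 0) (xs ! 1) (xs ! 2))"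
  unfolding nearest_def digit_def
  by (intro computable_intros computable_op_compose3[OF computable_op_fits] fits_exists) simp_all

text \<open>
  The search for \<open>K\<close> is the outermost one; everything that happens after it is total.
\<close>

lemma decode_program:
  obtains p where "\<And>X x. \<exists>K. settled X (floor_log (Suc x)) K \<Longrightarrow> computes X p [x] (decode X x)"
proof -
  have "computable_op 2 (\<lambda>X xs. of_bool (\<not> settled X (floor_log (Suc (xs ! 1))) (xs ! 0)))"
    by (intro computable_op_compose2[OF computable_op_settled] computable_intros) simp_all
  then obtain s where s: "\<And>X xs. length xs = 2 \<Longrightarrow>
      computes X s xs (of_bool (\<not> settled X (floor_log (Suc (xs ! 1))) (xs ! 0)))"
    unfolding computable_op_def by blast
  have "computable_op 2 (\<lambda>X xs. nearest X (floor_log (Suc (xs ! 0))) (xs ! 1)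
      (Suc (xs ! 0) - 2 ^ floor_log (Suc (xs ! 0))))"
    by (intro computable_op_compose3[OF computable_op_nearest] computable_intros) simp_all
  then obtain q where q: "\<And>X xs. length xs = 2 \<Longrightarrow> computes X q xs
      (nearest X (floor_log (Suc (xs ! 0))) (xs ! 1) (Suc (xs ! 0) - 2 ^ floor_log (Suc (xs ! 0))))"
    unfolding computable_op_def by blast
  have "computes X (Comp q [Proj 0, Mu s]) [x] (decode X x)"
    if "\<exists>K. settled X (floor_log (Suc x)) K" for X x
  proof (rule computes.comp)
    have "computes X (Mu s) [x] (LEAST K. settled X (floor_log (Suc x)) K)"
      using s[of "[_, x]" X] that by (intro computes_Mu_Least) auto
    then show "list_all2 (\<lambda>q y. computes X q [x] y) [Proj 0, Mu s]
        [x, LEAST K. settled X (floor_log (Suc x)) K]"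
      using computes.proj[of 0 "[x]" X] by simp
    show "computes X q [x, LEAST K. settled X (floor_log (Suc x)) K] (decode X x)"
      using q[of "[x, LEAST K. settled X (floor_log (Suc x)) K]" X] by (simp add: decode_def Let_def)
  qed
  then show thesis
    using that by blast
qed

text \<open>
  Taken as \<open>\<Gamma>'\<close>, this functional is computable by construction, and only its values at coarse
  descriptions of codes have to be determined.
\<close>

definition induced_functional ::
  "(nat \<Rightarrow> nat) set \<Rightarrow> rel_prog \<Rightarrow> (nat \<Rightarrow> nat) \<rightharpoonup> (nat \<Rightarrow> nat)" where
  "induced_functional A p f =
     (if f \<in> A \<and> (\<forall>x. \<exists>y. computes f p [x] y) then Some (\<lambda>x. THE y. computes f p [x] y) else None)"

lemma induced_functional_eq_Some_iff:
  "induced_functional A p f = Some g \<longleftrightarrow> f \<in> A \<and> (\<forall>x. computes f p [x] (g x))"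
proof -
  have the: "(THE y. computes f p [x] y) = y" if "computes f p [x] y" for x y
    using that computes_deterministic by blast
  show ?thesis
  proof
    assume "induced_functional A p f = Some g"
    then have "f \<in> A" "\<And>x. \<exists>y. computes f p [x] y" "g = (\<lambda>x. THE y. computes f p [x] y)"
      by (auto simp: induced_functional_def split: if_splits)
    then show "f \<in> A \<and> (\<forall>x. computes f p [x] (g x))"
      using the by metis
  next
    assume "f \<in> A \<and> (\<forall>x. computes f p [x] (g x))"
    then show "induced_functional A p f = Some g"
      by (auto simp: induced_functional_def the)
  qed
qed

lemma partial_computable_induced_functional:
  "partial_computable_functional A UNIV (induced_functional A p)"
  by (auto simp: partial_computable_functional_def induced_functional_eq_Some_iff)

lemma computable_functional_encode: "computable_functional cantor encode"
proof -
  obtain p where p: "\<And>f xs. length xs = 1 \<Longrightarrow> computes f p xs (encode f (xs ! 0))"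
    using computable_op_encode unfolding computable_op_def by blast
  have "computes f p [x] (encode f x)" for f x
    using p[of "[x]" f] by simp
  then have "encode f = g \<longleftrightarrow> (\<forall>x. computes f p [x] (g x))" for f g
    using computes_deterministic by blast
  moreover have "ran (\<lambda>f. Some (encode f)) \<subseteq> cantor"
    using encode_in_cantor by (auto simp: ran_def)
  ultimately show ?thesis
    by (auto simp: computable_functional_def partial_computable_functional_def)
qed

theorem theorem3:
  "\<exists>(\<Gamma> :: (nat \<Rightarrow> nat) \<Rightarrow> (nat \<Rightarrow> nat)) (\<Gamma>' :: (nat \<Rightarrow> nat) \<rightharpoonup> (nat \<Rightarrow> nat)).
     computable_functional cantor \<Gamma> \<and>
     partial_computable_functional cantor UNIV \<Gamma>' \<and>
     (\<forall>f.
        uniform_coarse_reduction UNIV (\<lambda>h. Some (\<Gamma> h)) (\<Gamma> f) f \<and>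
        \<Gamma>' (\<Gamma> f) = Some f \<and>
        uniform_coarse_reduction cantor \<Gamma>' f (\<Gamma> f))"
proof -
  obtain p where p: "\<And>X x. \<exists>K. settled X (floor_log (Suc x)) K \<Longrightarrow> computes X p [x] (decode X x)"
    using decode_program by blast
  let ?D = "induced_functional cantor p"
  have D: "?D X = Some (decode X)" if "X \<in> cantor" "coarse_description X (encode f)" for X f
    using that(1) p settled_exists[OF that(2)] by (simp add: induced_functional_eq_Some_iff)
  have "uniform_coarse_reduction UNIV (\<lambda>h. Some (encode h)) (encode f) f" for f
    using coarse_description_encode by (simp add: uniform_coarse_reduction_def)
  moreover have "?D (encode f) = Some f" for f
    using D[OF encode_in_cantor, of f f] decode_encode[of f]
    by (simp add: coarse_description_def density_zero_def)
  moreover have "uniform_coarse_reduction cantor ?D f (encode f)" for f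
    using D coarse_description_decode by (auto simp: uniform_coarse_reduction_def)
  ultimately show ?thesis
    using computable_functional_encode partial_computable_induced_functional by blast
qed

end
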